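(* Let $N$ be a loop, $H$ a group, $\phi:H\to Sym(N)_1$ a group homomorphism, and $L=N\rtimes_\phi H$. Then the left nucleus of $L$ is $$N_\lambda(L)=\{(x,y)\in N\times H\mid x\cdot\phi_y(n\phi_h(n'))=(x\phi_y(n))\cdot\phi_{yh}(n')\ \text{for all } h\in H,\ n,n'\in N\}.$$
   Context: A loop is a non-empty set with a binary operation such that for all $a,b$ the equations $xa=b$ and $ax=b$ have unique solutions, and there is a two-sided identity $1$. $Sym(N)_1$ is the stabilizer of $1$ in the group of permutations of $N$; write $\phi_h=\phi(h)$. $N\rtimes_\phi H$ is the loop on $N\times H$ with operation $(n_1,h_1)(n_2,h_2)=(n_1\phi_{h_1}(n_2),h_1h_2)$. For a loop $Q$, the left nucleus is $N_\lambda(Q)=\{a\in Q\mid a(xy)=(ax)y\ \forall x,y\in Q\}$. *)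

theory Defs
  imports "HOL-Algebra.Group_Action"
begin

(* The record type "monoid" only supplies carrier, product and identity; associativity is an
   axiom of the locale "monoid", which is not assumed here. Non-emptiness of the carrier
   follows from one_closed. *)
locale loop =
  fixes Q (structure)
  assumes m_closed: "\<lbrakk>x \<in> carrier Q; y \<in> carrier Q\<rbrakk> \<Longrightarrow> x \<otimes> y \<in> carrier Q"
    and one_closed: "\<one> \<in> carrier Q"
    and l_one: "x \<in> carrier Q \<Longrightarrow> \<one> \<otimes> x = x"
    and r_one: "x \<in> carrier Q \<Longrightarrow> x \<otimes> \<one> = x"
    and l_div: "\<lbrakk>a \<in> carrier Q; b \<in> carrier Q\<rbrakk> \<Longrightarrow> \<exists>!x. x \<in> carrier Q \<and> x \<otimes> a = b"
    and r_div: "\<lbrakk>a \<in> carrier Q; b \<in> carrier Q\<rbrakk> \<Longrightarrow> \<exists>!x. x \<in> carrier Q \<and> a \<otimes> x = b"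

definition left_nucleus :: "('a, 'm) monoid_scheme \<Rightarrow> 'a set" where
  "left_nucleus Q = {a \<in> carrier Q. \<forall>x \<in> carrier Q. \<forall>y \<in> carrier Q.
     a \<otimes>\<^bsub>Q\<^esub> (x \<otimes>\<^bsub>Q\<^esub> y) = (a \<otimes>\<^bsub>Q\<^esub> x) \<otimes>\<^bsub>Q\<^esub> y}"

(* The product of BijGroup is composition of maps acting on the left:
   (f \<otimes> g) x = f (g x). *)
definition Sym1 :: "('a, 'm) monoid_scheme \<Rightarrow> ('a \<Rightarrow> 'a) monoid" where
  "Sym1 N = (BijGroup (carrier N))
     \<lparr>carrier := stabilizer (BijGroup (carrier N)) (\<lambda>f. f) \<one>\<^bsub>N\<^esub>\<rparr>"

definition semidirect_loop ::
  "('a, 'm) monoid_scheme \<Rightarrow> ('b, 'k) monoid_scheme \<Rightarrow> ('b \<Rightarrow> 'a \<Rightarrow> 'a) \<Rightarrow> ('a \<times> 'b) monoid" where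
  "semidirect_loop N H \<phi> =
     \<lparr>carrier = carrier N \<times> carrier H,
      mult = (\<lambda>(n1, h1) (n2, h2). (n1 \<otimes>\<^bsub>N\<^esub> \<phi> h1 n2, h1 \<otimes>\<^bsub>H\<^esub> h2)),
      one = (\<one>\<^bsub>N\<^esub>, \<one>\<^bsub>H\<^esub>)\<rparr>"

lemma carrier_semidirect_loop [simp]:
  "carrier (semidirect_loop N H \<phi>) = carrier N \<times> carrier H"
  by (simp add: semidirect_loop_def)

lemma mult_semidirect_loop [simp]:
  "(n1, h1) \<otimes>\<^bsub>semidirect_loop N H \<phi>\<^esub> (n2, h2) = (n1 \<otimes>\<^bsub>N\<^esub> \<phi> h1 n2, h1 \<otimes>\<^bsub>H\<^esub> h2)"
  by (simp add: semidirect_loop_def)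

lemma one_semidirect_loop [simp]:
  "\<one>\<^bsub>semidirect_loop N H \<phi>\<^esub> = (\<one>\<^bsub>N\<^esub>, \<one>\<^bsub>H\<^esub>)"
  by (simp add: semidirect_loop_def)

lemma hom_Sym1D:
  assumes "\<phi> \<in> hom H (Sym1 N)"
  shows "h \<in> carrier H \<Longrightarrow> bij_betw (\<phi> h) (carrier N) (carrier N)"
    and "h \<in> carrier H \<Longrightarrow> \<phi> h \<one>\<^bsub>N\<^esub> = \<one>\<^bsub>N\<^esub>"
    and "\<lbrakk>h \<in> carrier H; k \<in> carrier H; n \<in> carrier N\<rbrakk> \<Longrightarrow> \<phi> (h \<otimes>\<^bsub>H\<^esub> k) n = \<phi> h (\<phi> k n)"
  using assms
  by (auto simp: hom_def Sym1_def stabilizer_def BijGroup_def Bij_def Pi_iff compose_def)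

lemma hom_Sym1_one:
  assumes "group H" "\<phi> \<in> hom H (Sym1 N)" "n \<in> carrier N"
  shows "\<phi> \<one>\<^bsub>H\<^esub> n = n"
proof -
  interpret H: group H by fact
  have b: "bij_betw (\<phi> \<one>\<^bsub>H\<^esub>) (carrier N) (carrier N)"
    using hom_Sym1D(1)[OF assms(2)] by simp
  have "\<phi> \<one>\<^bsub>H\<^esub> (\<phi> \<one>\<^bsub>H\<^esub> n) = \<phi> \<one>\<^bsub>H\<^esub> n"
    using hom_Sym1D(3)[OF assms(2) H.one_closed H.one_closed assms(3)] by simp
  then show ?thesis
    using inj_onD[OF bij_betw_imp_inj_on[OF b]] bij_betw_apply[OF b] assms(3) by blast
qed

theorem loop_semidirect_loop:
  assumes "loop N" "group H" "\<phi> \<in> hom H (Sym1 N)"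
  shows "loop (semidirect_loop N H \<phi>)"
proof -
  interpret N: loop N by fact
  interpret H: group H by fact
  note bij = hom_Sym1D(1)[OF assms(3)] and fix1 = hom_Sym1D(2)[OF assms(3)]
  have cl: "\<phi> h n \<in> carrier N" if "h \<in> carrier H" "n \<in> carrier N" for h n
    using bij[OF that(1)] that(2) by (rule bij_betw_apply)
  show ?thesis
  proof
    fix a b assume "a \<in> carrier (semidirect_loop N H \<phi>)" "b \<in> carrier (semidirect_loop N H \<phi>)"
    then obtain m k n h where a: "a = (m, k)" "m \<in> carrier N" "k \<in> carrier H"
      and b: "b = (n, h)" "n \<in> carrier N" "h \<in> carrier H" by auto
    define g where "g = h \<otimes>\<^bsub>H\<^esub> inv\<^bsub>H\<^esub> k"
    have g: "g \<in> carrier H" "g \<otimes>\<^bsub>H\<^esub> k = h" using a b by (auto simp: g_def H.m_assoc)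
    have gu: "g' = g" if "g' \<in> carrier H" "g' \<otimes>\<^bsub>H\<^esub> k = h" for g'
      using that g H.right_cancel[OF a(3) that(1) g(1)] by simp
    obtain u where u: "u \<in> carrier N" "u \<otimes>\<^bsub>N\<^esub> \<phi> g m = n"
      "\<And>v. v \<in> carrier N \<Longrightarrow> v \<otimes>\<^bsub>N\<^esub> \<phi> g m = n \<Longrightarrow> v = u"
      using N.l_div[OF cl[OF g(1) a(2)] b(2)] by blast
    show "\<exists>!x. x \<in> carrier (semidirect_loop N H \<phi>) \<and> x \<otimes>\<^bsub>semidirect_loop N H \<phi>\<^esub> a = b"
    proof (rule ex1I[of _ "(u, g)"])
      show "(u, g) \<in> carrier (semidirect_loop N H \<phi>) \<and> (u, g) \<otimes>\<^bsub>semidirect_loop N H \<phi>\<^esub> a = b"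
        using a b g u(1,2) by simp
      fix x assume "x \<in> carrier (semidirect_loop N H \<phi>) \<and> x \<otimes>\<^bsub>semidirect_loop N H \<phi>\<^esub> a = b"
      then obtain v f where "x = (v, f)" "v \<in> carrier N" "f \<in> carrier H"
          "v \<otimes>\<^bsub>N\<^esub> \<phi> f m = n" "f \<otimes>\<^bsub>H\<^esub> k = h"
        using a b by (cases x) auto
      then show "x = (u, g)" using gu u(3) by blast
    qed
    define g' where "g' = inv\<^bsub>H\<^esub> k \<otimes>\<^bsub>H\<^esub> h"
    have g': "g' \<in> carrier H" "k \<otimes>\<^bsub>H\<^esub> g' = h"
      using a b by (auto simp: g'_def H.m_assoc[symmetric])
    have gu': "f = g'" if "f \<in> carrier H" "k \<otimes>\<^bsub>H\<^esub> f = h" for f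
      using that g' H.Units_l_cancel[OF _ that(1) g'(1)] a(3) H.Units_eq by metis
    obtain w where w: "w \<in> carrier N" "m \<otimes>\<^bsub>N\<^esub> w = n"
      "\<And>v. v \<in> carrier N \<Longrightarrow> m \<otimes>\<^bsub>N\<^esub> v = n \<Longrightarrow> v = w"
      using N.r_div[OF a(2) b(2)] by blast
    obtain u' where u': "u' \<in> carrier N" "\<phi> k u' = w"
      using bij[OF a(3)] w(1) by (metis bij_betw_imp_surj_on imageE)
    have uu': "v = u'" if "v \<in> carrier N" "m \<otimes>\<^bsub>N\<^esub> \<phi> k v = n" for v
      using inj_onD[OF bij_betw_imp_inj_on[OF bij[OF a(3)]]]
        w(3)[OF cl[OF a(3) that(1)] that(2)] u' that(1) by blast
    show "\<exists>!x. x \<in> carrier (semidirect_loop N H \<phi>) \<and> a \<otimes>\<^bsub>semidirect_loop N H \<phi>\<^esub> x = b"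
    proof (rule ex1I[of _ "(u', g')"])
      show "(u', g') \<in> carrier (semidirect_loop N H \<phi>) \<and> a \<otimes>\<^bsub>semidirect_loop N H \<phi>\<^esub> (u', g') = b"
        using a b g' u' w(1,2) by simp
      fix x assume "x \<in> carrier (semidirect_loop N H \<phi>) \<and> a \<otimes>\<^bsub>semidirect_loop N H \<phi>\<^esub> x = b"
      then obtain v f where "x = (v, f)" "v \<in> carrier N" "f \<in> carrier H"
          "m \<otimes>\<^bsub>N\<^esub> \<phi> k v = n" "k \<otimes>\<^bsub>H\<^esub> f = h"
        using a b by (cases x) auto
      then show "x = (u', g')" using gu' uu' by blast
    qed
  qed (auto simp: N.m_closed N.one_closed N.l_one N.r_one cl fix1 hom_Sym1_one[OF assms(2,3)])
qed

end

theory Submission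
  imports Defs
begin

text \<open>Multiplying out both bracketings of \<open>(x, y) (n, h) (n', k)\<close> turns associativity in \<open>L\<close>
  into one equation in \<open>N\<close> and one in \<open>H\<close>. The latter is associativity in the group \<open>H\<close>; the former
  is the stated condition, and it does not involve \<open>k\<close>. So the quantifier over \<open>k\<close> in the
  definition of the left nucleus disappears, by taking \<open>k = \<one>\<close>.\<close>

theorem theorem3p7:
  fixes N :: "('a, 'm) monoid_scheme" and H :: "('b, 'k) monoid_scheme"
    and \<phi> :: "'b \<Rightarrow> 'a \<Rightarrow> 'a"
  assumes "loop N" and "group H" and "\<phi> \<in> hom H (Sym1 N)"
  shows "left_nucleus (semidirect_loop N H \<phi>) =
    {(x, y) \<in> carrier N \<times> carrier H.
       \<forall>h \<in> carrier H. \<forall>n \<in> carrier N. \<forall>n' \<in> carrier N.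
         x \<otimes>\<^bsub>N\<^esub> \<phi> y (n \<otimes>\<^bsub>N\<^esub> \<phi> h n') = (x \<otimes>\<^bsub>N\<^esub> \<phi> y n) \<otimes>\<^bsub>N\<^esub> \<phi> (y \<otimes>\<^bsub>H\<^esub> h) n'}"
proof -
  interpret H: group H by fact
  \<comment> \<open>The element \<open>\<one>\<close> only witnesses that the carrier of \<open>H\<close>, the range of \<open>k\<close>, is non-empty.\<close>
  show ?thesis
    using H.one_closed by (fastforce simp: left_nucleus_def H.m_assoc)
qed

end
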